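(* Let $n>2$ and let $(x_1,y_1),\dots,(x_n,y_n)$ be i.i.d. random pairs in $\mathbb{R}^2\times\{-1,+1\}$ with $x_j\sim\mathcal{N}(0,I_2)$. Suppose that $y$ follows the sign-flip noise model (without intercept) with parameter $\delta$: for some $\beta^*\in S^{1}$, $\mathbb{P}[y_j=1\mid x_j]=\delta$ if $x_j^T\beta^*>0$ and $\mathbb{P}[y_j=1\mid x_j]=1-\delta$ if $x_j^T\beta^*\le0$. Then the probability of linear separability without intercept is $$ S(n,2)=\delta^n+(1-\delta)^n+2\sum_{N=1}^{n-1}\delta^N(1-\delta)^{n-N}. $$
   Context: $S^1$ is the Euclidean unit sphere in $\mathbb{R}^2$. The probability of linear separability without intercept is $S(n,2):=\mathbb{P}\big[\bigcup_{\beta\in\mathbb{R}^2}\bigcap_{j=1}^n\{y_jx_j^T\beta>0\}\big]$. *)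

theory Defs
  imports "HOL-Probability.Probability"
begin

text \<open>Density of \<open>N(0, I)\<close> with respect to Lebesgue measure.\<close>

definition std_normal_vec_density :: "'v::euclidean_space \<Rightarrow> real" where
  "std_normal_vec_density x = exp (- (norm x)\<^sup>2 / 2) / sqrt (2 * pi) ^ DIM('v)"

definition iid :: "'w measure \<Rightarrow> 'b measure \<Rightarrow> 'i set \<Rightarrow> ('i \<Rightarrow> 'w \<Rightarrow> 'b) \<Rightarrow> bool" where
  "iid M N I Z \<longleftrightarrow>
     prob_space.indep_vars M (\<lambda>_. N) Z I \<and>
     (\<forall>i\<in>I. \<forall>j\<in>I. distr M N (Z i) = distr M N (Z j))"

text \<open>Conditional probability of the event \<open>A\<close> given the random vector \<open>X\<close>, i.e. given the
  sigma-algebra generated by \<open>X\<close>; it is determined only up to null sets.\<close>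

definition cond_prob_given :: "'w measure \<Rightarrow> 'w set \<Rightarrow> ('w \<Rightarrow> 'v::euclidean_space) \<Rightarrow> 'w \<Rightarrow> real" where
  "cond_prob_given M A X = real_cond_exp M (vimage_algebra (space M) X borel) (indicator A)"

definition sign_flip_noise ::
    "'w measure \<Rightarrow> nat \<Rightarrow> (nat \<Rightarrow> 'w \<Rightarrow> 'v::euclidean_space) \<Rightarrow> (nat \<Rightarrow> 'w \<Rightarrow> real) \<Rightarrow> real \<Rightarrow> bool" where
  "sign_flip_noise M n X Y \<delta> \<longleftrightarrow>
     (\<exists>\<beta>\<in>sphere 0 1. \<forall>j\<in>{1..n}. AE \<omega> in M.
        cond_prob_given M {\<omega> \<in> space M. Y j \<omega> = 1} (X j) \<omega> =
          (if X j \<omega> \<bullet> \<beta> > 0 then \<delta> else 1 - \<delta>))"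

definition separability_prob ::
    "'w measure \<Rightarrow> nat \<Rightarrow> (nat \<Rightarrow> 'w \<Rightarrow> 'v::euclidean_space) \<Rightarrow> (nat \<Rightarrow> 'w \<Rightarrow> real) \<Rightarrow> real" where
  "separability_prob M n X Y =
     measure M {\<omega> \<in> space M. \<exists>\<beta>. \<forall>j\<in>{1..n}. Y j \<omega> * (X j \<omega> \<bullet> \<beta>) > 0}"

end

theory Submission
  imports Defs
begin

text \<open>Let \<open>S j\<close> say whether \<open>Y j\<close> agrees with the sign of \<open>X j \<bullet> \<beta>\<close>. On either side of the line orthogonal to
  \<open>\<beta>\<close> the event \<open>S j\<close> has conditional probability \<open>\<delta>\<close>, so \<open>S j\<close> is independent of \<open>X j\<close>, although \<open>Y j\<close> is
  not. Write a direction as \<open>a \<beta> + c \<gamma>\<close> with \<open>\<gamma> \<bottom> \<beta>\<close> and let \<open>t j = (X j \<bullet> \<gamma>) / (X j \<bullet> \<beta>)\<close>. This direction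
  separates the data iff \<open>a + c t j\<close> is positive exactly for those \<open>j\<close> with \<open>S j\<close>, and negative for the
  others. Almost surely the \<open>t j\<close> are distinct, and then the sets of indices that an affine function
  of \<open>t\<close> can cut out are the initial and the final segments in the order of \<open>t\<close>: two of each size
  between \<open>1\<close> and \<open>n - 1\<close>, and one each of size \<open>0\<close> and \<open>n\<close>. Hence the conditional probability of
  separability given the \<open>X j\<close> is almost surely constant.\<close>

subsection \<open>Subsets cut out by affine functions\<close>

text \<open>The bound \<open>k\<close> is the least number outside \<open>D\<close>: everything
  below it lies in \<open>D\<close> by minimality, and an element of \<open>D\<close> above it would
  force \<open>k\<close> into \<open>D\<close>.\<close>

lemma downward_closed_eq_lessThan:
  fixes D :: "nat set"
  assumes "D \<subseteq> {..<n}" and "\<And>i j. j \<in> D \<Longrightarrow> i < j \<Longrightarrow> i \<in> D"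
  obtains k where "k \<le> n" "D = {..<k}"
proof -
  define k where "k = (LEAST k. k \<notin> D)"
  have "n \<notin> D" using assms(1) by auto
  then have "k \<notin> D" "k \<le> n"
    unfolding k_def using LeastI[of "\<lambda>k. k \<notin> D" n] Least_le[of "\<lambda>k. k \<notin> D" n] by auto
  moreover have "i \<in> D" if "i < k" for i using not_less_Least that unfolding k_def by blast
  ultimately have "D = {..<k}"
    by (metis assms(2) lessThan_iff linorder_neqE_nat subsetI subset_antisym)
  with \<open>k \<le> n\<close> that show thesis by blast
qed

text \<open>The values of \<open>t\<close> are sorted and pulled back along the inverse of
  \<open>t\<close>, so \<open>e\<close> lists \<open>I\<close> in the order of \<open>t\<close>.
  Injectivity excludes ties, which makes the order strict.\<close>

lemma finite_inj_on_strict_mono_enumeration: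
  fixes t :: "'i \<Rightarrow> 'a::linorder"
  assumes "finite I" "inj_on t I"
  obtains e where "bij_betw e {..<card I} I" "strict_mono_on {..<card I} (\<lambda>k. t (e k))"
proof -
  define xs where "xs = sorted_list_of_set (t ` I)"
  have len: "length xs = card I" using assms by (simp add: xs_def card_image)
  have st: "sorted_wrt (<) xs" by (simp add: xs_def)
  have set: "set xs = t ` I" using assms by (simp add: xs_def)
  define e where "e k = inv_into I t (xs ! k)" for k
  have te: "t (e k) = xs ! k" if "k < card I" for k
    unfolding e_def using that len set by (metis f_inv_into_f nth_mem)
  have "bij_betw (\<lambda>k. xs ! k) {..<card I} (t ` I)"
    using bij_betw_nth[of xs] len set by (simp add: xs_def)
  moreover have "bij_betw (inv_into I t) (t ` I) I"
    by (simp add: assms(2) bij_betw_inv_into inj_on_imp_bij_betw)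
  ultimately have "bij_betw e {..<card I} I"
    unfolding e_def using bij_betw_trans by (fastforce simp: comp_def)
  moreover have "strict_mono_on {..<card I} (\<lambda>k. t (e k))"
    using te st len by (auto intro!: strict_mono_onI simp: sorted_wrt_iff_nth_less)
  ultimately show thesis using that by blast
qed

text \<open>Along \<open>e\<close> the function \<open>a + b * t\<close> is monotone, so it changes
  sign at most once and its positive set is an initial or a final segment; conversely a threshold
  between two neighbouring values of \<open>t\<close> realises each segment. The final segments with
  \<open>k = 0\<close> and \<open>k = n\<close> are left out on the right because they already occur
  as initial segments, so no set is listed twice.\<close>

lemma affine_separable_subsets:
  fixes t :: "'i \<Rightarrow> real" and n :: nat
  assumes e: "bij_betw e {..<n} I" and mono: "strict_mono_on {..<n} (\<lambda>k. t (e k))"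
  shows "{P. P \<subseteq> I \<and> (\<exists>a b. (\<forall>i\<in>P. 0 < a + b * t i) \<and> (\<forall>i\<in>I - P. a + b * t i < 0))} =
    (\<lambda>k. e ` {..<k}) ` {..n} \<union> (\<lambda>k. e ` {k..<n}) ` {1..<n}" (is "?L = ?R")
proof -
  have inj: "inj_on e {..<n}" and I: "I = e ` {..<n}" using e by (auto simp: bij_betw_def)
  have tless: "t (e i) < t (e j)" if "i < j" "j < n" for i j
    using strict_mono_onD[OF mono, of i j] that less_trans[OF that] by simp
  have compl: "e ` {..<n} - e ` A = e ` ({..<n} - A)" if "A \<subseteq> {..<n}" for A
    using inj that by (metis inj_on_image_set_diff Diff_subset order_refl)
  have seg: "e ` {..<k} \<in> ?L" "e ` {k..<n} \<in> ?L" if k: "k \<le> n" for k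
  proof -
    \<comment> \<open>A threshold \<open>c\<close> lies above the first \<open>k\<close> values and
      below the others. For \<open>k = 0\<close> or \<open>k = n\<close> one side is empty and
      \<open>c\<close> is taken beyond all values; otherwise it lies strictly between positions
      \<open>k - 1\<close> and \<open>k\<close>.\<close>
    have ex: "\<exists>c. (\<forall>i<k. t (e i) < c) \<and> (\<forall>i. k \<le> i \<longrightarrow> i < n \<longrightarrow> c < t (e i))"
    proof (cases "k = 0 \<or> k = n")
      case True
      have fin: "finite (t ` e ` {..<n})" by simp
      \<comment> \<open>Inserting \<open>0\<close> keeps the set nonempty when \<open>n = 0\<close>,
        so that \<open>Max\<close> and \<open>Min\<close> are meaningful.\<close>
      define u where "u = Max (insert 0 (t ` e ` {..<n})) + 1"
      define l where "l = Min (insert 0 (t ` e ` {..<n})) - 1"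
      have "t (e i) < u" "l < t (e i)" if "i < n" for i
      proof -
        have "t (e i) \<le> Max (insert 0 (t ` e ` {..<n}))" "Min (insert 0 (t ` e ` {..<n})) \<le> t (e i)"
          using that fin by (auto intro!: Max_ge Min_le)
        then show "t (e i) < u" "l < t (e i)" unfolding u_def l_def by linarith+
      qed
      from True show ?thesis
      proof
        assume "k = 0"
        then show ?thesis using \<open>\<And>i. i < n \<Longrightarrow> l < t (e i)\<close> by blast
      next
        assume "k = n"
        then show ?thesis using \<open>\<And>i. i < n \<Longrightarrow> t (e i) < u\<close> by (intro exI[of _ u]) auto
      qed
    next
      case False
      then have "t (e (k - 1)) < t (e k)" using tless k by auto
      then obtain c where c: "t (e (k - 1)) < c" "c < t (e k)" using dense by blast
      have "t (e i) < c" if "i < k" for i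
      proof -
        have "i = k - 1 \<or> i < k - 1 \<and> k - 1 < n" using that k by linarith
        then show ?thesis
        proof
          assume "i = k - 1"
          then show ?thesis using c(1) by blast
        next
          assume "i < k - 1 \<and> k - 1 < n"
          then show ?thesis using c(1) tless[of i "k - 1"] by linarith
        qed
      qed
      moreover have "c < t (e i)" if "k \<le> i" "i < n" for i
        using that c tless[of k i] by (cases "i = k") auto
      ultimately show ?thesis by blast
    qed
    then obtain c where c: "\<And>i. i < k \<Longrightarrow> t (e i) < c" "\<And>i. k \<le> i \<Longrightarrow> i < n \<Longrightarrow> c < t (e i)" by blast
    have "e ` {..<n} - e ` {..<k} = e ` {k..<n}" using compl[of "{..<k}"] k
      by (auto simp: lessThan_minus_lessThan)
    \<comment> \<open>The initial segment is cut out by \<open>c - t\<close>; further down, the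
      final one is cut out by \<open>t - c\<close>.\<close>
    then have "\<forall>i\<in>e ` {..<k}. 0 < c + (- 1) * t i" "\<forall>i\<in>I - e ` {..<k}. c + (- 1) * t i < 0"
      using c unfolding I by auto
    moreover have "e ` {..<k} \<subseteq> I" using k unfolding I by auto
    ultimately show "e ` {..<k} \<in> ?L" by (intro CollectI conjI exI)
    have "{..<n} - {k..<n} = {..<k}" using k by auto
    moreover have "e ` {..<n} - e ` {k..<n} = e ` ({..<n} - {k..<n})" by (rule compl) auto
    ultimately have "e ` {..<n} - e ` {k..<n} = e ` {..<k}" by simp
    then have "\<forall>i\<in>e ` {k..<n}. 0 < - c + 1 * t i" "\<forall>i\<in>I - e ` {k..<n}. - c + 1 * t i < 0"
      using c unfolding I by auto
    moreover have "e ` {k..<n} \<subseteq> I" unfolding I by auto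
    ultimately show "e ` {k..<n} \<in> ?L" by (intro CollectI conjI exI)
  qed
  have "P \<in> ?R" if "P \<in> ?L" for P
  proof -
    from that obtain a b where P: "P \<subseteq> I" "\<And>i. i \<in> P \<Longrightarrow> 0 < a + b * t i"
      "\<And>i. i \<in> I \<Longrightarrow> i \<notin> P \<Longrightarrow> a + b * t i < 0" by blast
    define D where "D = {k. k < n \<and> e k \<in> P}"
    have PD: "P = e ` D" using P(1) unfolding D_def I by auto
    have D: "k \<in> D \<longleftrightarrow> 0 < a + b * t (e k)" if "k < n" for k
    proof
      assume "k \<in> D"
      then show "0 < a + b * t (e k)" using P(2) by (simp add: D_def)
    next
      assume "0 < a + b * t (e k)"
      moreover have "e k \<in> I" using that by (simp add: I)
      ultimately have "e k \<in> P" using P(3)[of "e k"] by linarith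
      then show "k \<in> D" using that by (simp add: D_def)
    qed
    \<comment> \<open>The sign of \<open>b\<close> decides the kind of segment: for
      \<open>b \<le> 0\<close> the set \<open>D\<close> of positive positions is closed downwards,
      for \<open>b > 0\<close> its complement is. A constant function falls under the first
      case.\<close>
    show ?thesis
    proof (cases "b \<le> 0")
      case True
      have "i \<in> D" if "j \<in> D" "i < j" for i j
      proof -
        have "j < n" using that D_def by auto
        then have "b * t (e j) \<le> b * t (e i)"
          using tless[OF \<open>i < j\<close>] True by (simp add: mult_left_mono_neg)
        then show ?thesis using D \<open>j < n\<close> that by fastforce
      qed
      then obtain k where "k \<le> n" "D = {..<k}"
        using downward_closed_eq_lessThan[of D n] unfolding D_def by blast
      then show ?thesis using PD by (intro UnI1 image_eqI[of _ _ k]) simp_all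
    next
      case False
      have "i \<in> {..<n} - D" if "j \<in> {..<n} - D" "i < j" for i j
      proof -
        have "j < n" using that by auto
        then have "b * t (e i) \<le> b * t (e j)"
          using tless[OF \<open>i < j\<close>] False by (simp add: mult_left_mono)
        then show ?thesis using D \<open>j < n\<close> that by fastforce
      qed
      then obtain k where k: "k \<le> n" "{..<n} - D = {..<k}"
        using downward_closed_eq_lessThan[of "{..<n} - D" n] by blast
      have "D \<subseteq> {..<n}" by (auto simp: D_def)
      then have "D = {..<n} - {..<k}" using k(2) by blast
      then have Dk: "D = {k..<n}" by auto
      \<comment> \<open>The full and the empty final segment have to be presented as the initial
        segments of length \<open>n\<close> and \<open>0\<close>.\<close>
      consider "k = 0" | "k = n" | "k \<in> {1..<n}" using k(1) by fastforce
      then show ?thesis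
      proof cases
        case 1
        then have "P = e ` {..<n}" using PD Dk by (simp add: lessThan_atLeast0)
        then show ?thesis by (intro UnI1 image_eqI[of _ _ n]) simp_all
      next
        case 2
        then have "P = e ` {..<0}" using PD Dk by simp
        then show ?thesis by (intro UnI1 image_eqI[of _ _ 0]) simp_all
      next
        case 3
        then show ?thesis using PD Dk by (intro UnI2 image_eqI[of _ _ k]) simp_all
      qed
    qed
  qed
  moreover have "P \<in> ?L" if "P \<in> ?R" for P
    using that
  proof
    assume "P \<in> (\<lambda>k. e ` {..<k}) ` {..n}"
    then obtain k where "P = e ` {..<k}" "k \<le> n" by auto
    then show ?thesis using seg(1)[of k] by simp
  next
    assume "P \<in> (\<lambda>k. e ` {k..<n}) ` {1..<n}"
    then obtain k where "P = e ` {k..<n}" "k \<le> n" by auto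
    then show ?thesis using seg(2)[of k] by simp
  qed
  ultimately show ?thesis by (intro subset_antisym subsetI)
qed

text \<open>The weight depends only on the size of \<open>P\<close>. Initial segments contribute
  every size from \<open>0\<close> to \<open>n\<close> once, and the proper nonempty final segments
  contribute every size from \<open>1\<close> to \<open>n - 1\<close> once more. For empty
  \<open>I\<close> the sets of size \<open>0\<close> and of full size coincide, so the right-hand
  side would count one set twice.\<close>

lemma sum_affine_separable_subsets:
  fixes t :: "'i \<Rightarrow> real" and p q :: real
  assumes "finite I" "inj_on t I" "I \<noteq> {}"
  shows "(\<Sum>P | P \<subseteq> I \<and> (\<exists>a b. (\<forall>i\<in>P. 0 < a + b * t i) \<and> (\<forall>i\<in>I - P. a + b * t i < 0)).
      p ^ card P * q ^ card (I - P)) =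
    p ^ card I + q ^ card I + 2 * (\<Sum>N = 1..card I - 1. p ^ N * q ^ (card I - N))"
proof -
  define n where "n = card I"
  have n: "n > 0" using assms by (simp add: n_def card_gt_0_iff)
  obtain e where e: "bij_betw e {..<n} I" and mono: "strict_mono_on {..<n} (\<lambda>k. t (e k))"
    using finite_inj_on_strict_mono_enumeration[OF assms(1,2)] unfolding n_def by blast
  have inj: "inj_on e {..<n}" and I: "I = e ` {..<n}" using e by (auto simp: bij_betw_def)
  have cardL: "card (e ` {..<k}) = k" if "k \<le> n" for k
    using card_image[OF inj_on_subset[OF inj], of "{..<k}"] that by simp
  have cardU: "card (e ` {k..<n}) = n - k" for k
  proof -
    have "{k..<n} \<subseteq> {..<n}" by auto
    from card_image[OF inj_on_subset[OF inj this]] show ?thesis by simp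
  qed
  have cardD: "card (I - P) = n - card P" if "P \<subseteq> I" for P
    using that assms(1) by (simp add: n_def card_Diff_subset finite_subset)
  let ?w = "\<lambda>P. p ^ card P * q ^ card (I - P)"
  have injL: "inj_on (\<lambda>k. e ` {..<k}) {..n}"
    by (rule inj_onI) (metis cardL atMost_iff)
  have injU: "inj_on (\<lambda>k. e ` {k..<n}) {1..<n}"
  proof (rule inj_onI)
    fix k l assume "k \<in> {1..<n}" "l \<in> {1..<n}" "e ` {k..<n} = e ` {l..<n}"
    then have "n - k = n - l" "k < n" "l < n" using cardU[of k] cardU[of l] by simp_all
    then show "k = l" by linarith
  qed
  \<comment> \<open>A final segment with \<open>1 \<le> m < n\<close> contains position
    \<open>n - 1\<close> but not position \<open>0\<close>, while a nonempty initial segment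
    contains \<open>0\<close>.\<close>
  have "e ` {..<k} \<noteq> e ` {m..<n}" if "k \<le> n" "m \<in> {1..<n}" for k m
  proof
    assume "e ` {..<k} = e ` {m..<n}"
    moreover have "{m..<n} \<subseteq> {..<n}" "{..<k} \<subseteq> {..<n}" using that by auto
    ultimately have eq: "{..<k} = {m..<n}"
      using inj_on_image_eq_iff[OF inj] by blast
    have "n - 1 \<in> {m..<n}" "0 \<notin> {m..<n}" using that by auto
    then show False unfolding eq[symmetric] by simp
  qed
  then have disj: "(\<lambda>k. e ` {..<k}) ` {..n} \<inter> (\<lambda>k. e ` {k..<n}) ` {1..<n} = {}" by blast
  have "(\<Sum>P | P \<subseteq> I \<and> (\<exists>a b. (\<forall>i\<in>P. 0 < a + b * t i) \<and> (\<forall>i\<in>I - P. a + b * t i < 0)). ?w P) =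
      sum ?w ((\<lambda>k. e ` {..<k}) ` {..n}) + sum ?w ((\<lambda>k. e ` {k..<n}) ` {1..<n})"
    unfolding affine_separable_subsets[OF e mono] using disj by (intro sum.union_disjoint finite_imageI) simp_all
  also have "sum ?w ((\<lambda>k. e ` {..<k}) ` {..n}) = (\<Sum>k\<le>n. p ^ k * q ^ (n - k))"
    unfolding sum.reindex[OF injL] comp_def
  proof (rule sum.cong[OF refl])
    fix k assume "k \<in> {..n}"
    then have "e ` {..<k} \<subseteq> I" "k \<le> n" unfolding I by auto
    then show "?w (e ` {..<k}) = p ^ k * q ^ (n - k)" by (simp only: cardD cardL)
  qed
  also have "\<dots> = p ^ n + q ^ n + (\<Sum>N = 1..n - 1. p ^ N * q ^ (n - N))"
  proof -
    \<comment> \<open>The two extreme sizes are split off; \<open>n > 0\<close> makes them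
      distinct.\<close>
    have "{..n} = insert 0 (insert n {1..n - 1})" using n by auto
    then have "(\<Sum>k\<le>n. p ^ k * q ^ (n - k)) = (\<Sum>k\<in>insert 0 (insert n {1..n - 1}). p ^ k * q ^ (n - k))"
      by (rule arg_cong)
    also have "\<dots> = p ^ 0 * q ^ (n - 0) + (p ^ n * q ^ (n - n) + (\<Sum>N = 1..n - 1. p ^ N * q ^ (n - N)))"
      using n by (subst sum.insert, simp, simp, subst sum.insert) auto
    finally show ?thesis by simp
  qed
  also have "sum ?w ((\<lambda>k. e ` {k..<n}) ` {1..<n}) = (\<Sum>k = 1..<n. p ^ (n - k) * q ^ k)"
    unfolding sum.reindex[OF injU] comp_def
  proof (rule sum.cong[OF refl])
    fix k assume "k \<in> {1..<n}"
    then have "e ` {k..<n} \<subseteq> I" "k \<le> n" unfolding I by auto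
    then show "?w (e ` {k..<n}) = p ^ (n - k) * q ^ k" by (simp only: cardD cardU diff_diff_cancel)
  qed
  also have "\<dots> = (\<Sum>N = 1..n - 1. p ^ N * q ^ (n - N))"
    by (rule sum.reindex_bij_witness[of _ "\<lambda>k. n - k" "\<lambda>k. n - k"]) auto
  finally show ?thesis by (simp add: n_def)
qed

subsection \<open>Independence of flips and regressors\<close>

text \<open>The existential ranges over uncountably many directions. For fixed data the separating
  directions form an open set, so a countable dense set of candidates suffices.\<close>

lemma sets_exists_separating_direction:
  fixes X :: "'i \<Rightarrow> 'w \<Rightarrow> 'v::euclidean_space" and Y :: "'i \<Rightarrow> 'w \<Rightarrow> real"
  assumes "finite I"
    and [measurable]: "\<And>i. i \<in> I \<Longrightarrow> X i \<in> borel_measurable M"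
      "\<And>i. i \<in> I \<Longrightarrow> Y i \<in> borel_measurable M"
  shows "{\<omega> \<in> space M. \<exists>b. \<forall>i\<in>I. 0 < Y i \<omega> * (X i \<omega> \<bullet> b)} \<in> sets M"
proof -
  obtain D :: "'v set" where D: "countable D" "\<And>U. open U \<Longrightarrow> U \<noteq> {} \<Longrightarrow> \<exists>d\<in>D. d \<in> U"
    by (erule countable_dense_setE)
  have "(\<exists>b. \<forall>i\<in>I. 0 < Y i \<omega> * (X i \<omega> \<bullet> b)) \<longleftrightarrow> (\<exists>b\<in>D. \<forall>i\<in>I. 0 < Y i \<omega> * (X i \<omega> \<bullet> b))" for \<omega>
  proof -
    have "{b. \<forall>i\<in>I. 0 < Y i \<omega> * (X i \<omega> \<bullet> b)} = (\<Inter>i\<in>I. {b. 0 < Y i \<omega> * (X i \<omega> \<bullet> b)})" by auto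
    moreover have "open (\<Inter>i\<in>I. {b. 0 < Y i \<omega> * (X i \<omega> \<bullet> b)})"
      using assms(1) by (intro open_INT ballI open_Collect_less continuous_intros) auto
    ultimately show ?thesis using D(2)[of "{b. \<forall>i\<in>I. 0 < Y i \<omega> * (X i \<omega> \<bullet> b)}"] by auto
  qed
  then have "{\<omega> \<in> space M. \<exists>b. \<forall>i\<in>I. 0 < Y i \<omega> * (X i \<omega> \<bullet> b)} =
      {\<omega> \<in> space M. \<exists>b\<in>D. \<forall>i\<in>I. 0 < Y i \<omega> * (X i \<omega> \<bullet> b)}"
    by simp
  also have "\<dots> = (\<Union>b\<in>D. {\<omega> \<in> space M. \<forall>i\<in>I. 0 < Y i \<omega> * (X i \<omega> \<bullet> b)})" by blast
  also have "\<dots> \<in> sets M"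
  proof (intro sets.countable_UN'' D(1) sets.sets_Collect_finite_All assms(1))
    fix b i assume "b \<in> D" and [simp]: "i \<in> I"
    show "{\<omega> \<in> space M. 0 < Y i \<omega> * (X i \<omega> \<bullet> b)} \<in> sets M" by measurable
  qed
  finally show ?thesis .
qed

text \<open>The argument \<open>s\<close> records whether the label agrees with the side of the
  hyperplane. For fixed \<open>s\<close>, the noise model gives the event
  \<open>Y = flip_label \<beta> s X\<close> a conditional probability that does not depend on
  \<open>X\<close>. The hyperplane itself counts as the negative side, as in
  \<open>sign_flip_noise\<close>.\<close>

definition flip_label :: "'v::euclidean_space \<Rightarrow> bool \<Rightarrow> 'v \<Rightarrow> real" where
  "flip_label \<beta> s x = (if s \<longleftrightarrow> 0 < x \<bullet> \<beta> then 1 else - 1)"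

lemma borel_measurable_flip_label [measurable]: "flip_label \<beta> s \<in> borel_measurable borel"
  unfolding flip_label_def by measurable

text \<open>This is the averaging property of conditional expectation over the event
  \<open>X \<in> C\<close>, which belongs to the sigma-algebra generated by \<open>X\<close>. On
  that event the conditional probability is almost surely the constant \<open>c\<close>.\<close>

lemma (in prob_space) prob_cond_prob_given_eq:
  fixes X :: "'a \<Rightarrow> 'v::euclidean_space"
  assumes [measurable]: "X \<in> borel_measurable M" "B \<in> events" "C \<in> sets borel"
    and cp: "AE \<omega> in M. cond_prob_given M B X \<omega> = h (X \<omega>)"
    and h: "\<And>x. x \<in> C \<Longrightarrow> h x = c"
  shows "prob {\<omega> \<in> space M. \<omega> \<in> B \<and> X \<omega> \<in> C} = c * prob {\<omega> \<in> space M. X \<omega> \<in> C}"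
proof -
  define F where "F = vimage_algebra (space M) X borel"
  have "subalgebra M F"
    using assms(1) unfolding subalgebra_def F_def
    by (auto simp: sets_vimage_algebra2 intro: measurable_sets)
  then interpret finite_measure_subalgebra M F by unfold_locales
  have A: "{\<omega> \<in> space M. X \<omega> \<in> C} \<in> sets F"
  proof -
    have "{\<omega> \<in> space M. X \<omega> \<in> C} = X -` C \<inter> space M" by auto
    then show ?thesis unfolding F_def using assms(3) by (simp add: in_vimage_algebra)
  qed
  have [measurable]: "{\<omega> \<in> space M. X \<omega> \<in> C} \<in> events" by measurable
  have "prob {\<omega> \<in> space M. \<omega> \<in> B \<and> X \<omega> \<in> C} = (\<integral>\<omega>\<in>{\<omega> \<in> space M. X \<omega> \<in> C}. indicator B \<omega> \<partial>M)"
  proof -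
    have "(\<integral>\<omega>\<in>{\<omega> \<in> space M. X \<omega> \<in> C}. indicator B \<omega> \<partial>M) =
        (\<integral>\<omega>. indicat_real {\<omega> \<in> space M. \<omega> \<in> B \<and> X \<omega> \<in> C} \<omega> \<partial>M)"
      unfolding set_lebesgue_integral_def
      by (intro Bochner_Integration.integral_cong) (auto simp: indicator_def)
    then show ?thesis by simp
  qed
  also have "\<dots> = (\<integral>\<omega>\<in>{\<omega> \<in> space M. X \<omega> \<in> C}. real_cond_exp M F (indicator B) \<omega> \<partial>M)"
    by (rule real_cond_exp_intA[OF _ A]) (simp add: integrable_indicator_iff emeasure_eq_measure)
  also have "\<dots> = (\<integral>\<omega>. c * indicat_real {\<omega> \<in> space M. X \<omega> \<in> C} \<omega> \<partial>M)"
    unfolding set_lebesgue_integral_def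
  proof (rule integral_cong_AE)
    show "AE \<omega> in M. indicat_real {\<omega> \<in> space M. X \<omega> \<in> C} \<omega> *\<^sub>R real_cond_exp M F (indicator B) \<omega> =
        c * indicat_real {\<omega> \<in> space M. X \<omega> \<in> C} \<omega>"
      using cp by eventually_elim (auto simp: cond_prob_given_def F_def indicator_def h)
  qed measurable
  also have "\<dots> = c * prob {\<omega> \<in> space M. X \<omega> \<in> C}" by simp
  finally show ?thesis .
qed

text \<open>On the positive side agreement means label \<open>1\<close>, with conditional
  probability \<delta>. On the other side it means label \<open>-1\<close>, with conditional
  probability \<open>1 - (1 - \<delta>)\<close>, again \<delta>. Agreement is therefore independent
  of \<open>X\<close>.\<close>

lemma (in prob_space) prob_flip_label:
  fixes X :: "'a \<Rightarrow> 'v::euclidean_space" and Y :: "'a \<Rightarrow> real"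
  assumes X[measurable]: "X \<in> borel_measurable M" and Y[measurable]: "Y \<in> borel_measurable M"
    and Y_range: "\<And>\<omega>. \<omega> \<in> space M \<Longrightarrow> Y \<omega> \<in> {- 1, 1}"
    and cp: "AE \<omega> in M. cond_prob_given M {\<omega> \<in> space M. Y \<omega> = 1} X \<omega> =
      (if 0 < X \<omega> \<bullet> \<beta> then \<delta> else 1 - \<delta>)"
    and A[measurable]: "A \<in> sets borel"
  shows "prob {\<omega> \<in> space M. X \<omega> \<in> A \<and> Y \<omega> = flip_label \<beta> s (X \<omega>)} =
    (if s then \<delta> else 1 - \<delta>) * prob {\<omega> \<in> space M. X \<omega> \<in> A}"
proof -
  define H where "H = {x. 0 < x \<bullet> \<beta>}"
  have H[measurable]: "H \<in> sets borel" unfolding H_def by measurable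
  let ?B = "{\<omega> \<in> space M. Y \<omega> = 1}"
  let ?h = "\<lambda>x. if 0 < x \<bullet> \<beta> then \<delta> else 1 - \<delta>"
  let ?pX = "\<lambda>C. prob {\<omega> \<in> space M. X \<omega> \<in> C}"
  let ?pY = "\<lambda>y C. prob {\<omega> \<in> space M. Y \<omega> = y \<and> X \<omega> \<in> C}"
  have pos: "?pY 1 (A \<inter> H) = \<delta> * ?pX (A \<inter> H)"
    using prob_cond_prob_given_eq[of X ?B "A \<inter> H" ?h \<delta>, OF X _ _ cp] by (auto simp: H_def)
  have neg: "?pY 1 (A - H) = (1 - \<delta>) * ?pX (A - H)"
    using prob_cond_prob_given_eq[of X ?B "A - H" ?h "1 - \<delta>", OF X _ _ cp] by (auto simp: H_def)
  \<comment> \<open>The noise model only speaks of label \<open>1\<close>; since there are just two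
    labels, the probability for \<open>-1\<close> follows by subtraction.\<close>
  have compl: "?pY (- 1) C = ?pX C - ?pY 1 C" if [measurable]: "C \<in> sets borel" for C
  proof -
    have "?pX C = prob ({\<omega> \<in> space M. Y \<omega> = - 1 \<and> X \<omega> \<in> C} \<union> {\<omega> \<in> space M. Y \<omega> = 1 \<and> X \<omega> \<in> C})"
      using Y_range by (intro arg_cong[where f=prob]) blast
    also have "\<dots> = ?pY (- 1) C + ?pY 1 C" by (rule finite_measure_Union) auto
    finally show ?thesis by simp
  qed
  have split: "?pX A = ?pX (A \<inter> H) + ?pX (A - H)"
  proof -
    have "?pX A = prob ({\<omega> \<in> space M. X \<omega> \<in> A \<inter> H} \<union> {\<omega> \<in> space M. X \<omega> \<in> A - H})"
      by (intro arg_cong[where f=prob]) blast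
    also have "\<dots> = ?pX (A \<inter> H) + ?pX (A - H)" by (rule finite_measure_Union) auto
    finally show ?thesis .
  qed
  have "prob {\<omega> \<in> space M. X \<omega> \<in> A \<and> Y \<omega> = flip_label \<beta> s (X \<omega>)} =
      prob ({\<omega> \<in> space M. Y \<omega> = (if s then 1 else - 1) \<and> X \<omega> \<in> A \<inter> H} \<union>
        {\<omega> \<in> space M. Y \<omega> = (if s then - 1 else 1) \<and> X \<omega> \<in> A - H})"
    by (intro arg_cong[where f=prob]) (auto simp: flip_label_def H_def)
  also have "\<dots> = ?pY (if s then 1 else - 1) (A \<inter> H) + ?pY (if s then - 1 else 1) (A - H)"
    by (rule finite_measure_Union) auto
  also have "\<dots> = (if s then \<delta> else 1 - \<delta>) * ?pX A"
    using compl[of "A \<inter> H"] compl[of "A - H"]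
    by (cases s) (simp_all add: pos neg split algebra_simps del: Int_iff Diff_iff)
  finally show ?thesis .
qed

text \<open>This lifts the factorisation in each coordinate to the whole family, for events
  \<open>A\<close> that need not be boxes. Both sides are finite measures in \<open>A\<close>; by
  independence of the \<open>Z i\<close> they agree on boxes, which determine a finite measure on
  the product. In the application \<open>f i\<close> selects the regressor and \<open>E i\<close>
  fixes the agreement of the label.\<close>

lemma (in prob_space) prob_indep_vars_restrict:
  assumes indep: "indep_vars N Z I" and I: "finite I" "I \<noteq> {}"
    and f: "\<And>i. i \<in> I \<Longrightarrow> f i \<in> measurable (N i) (K i)"
    and E: "\<And>i. i \<in> I \<Longrightarrow> E i \<in> sets (N i)"
    and c: "\<And>i A. i \<in> I \<Longrightarrow> A \<in> sets (K i) \<Longrightarrow>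
      prob {\<omega> \<in> space M. f i (Z i \<omega>) \<in> A \<and> Z i \<omega> \<in> E i} = c i * prob {\<omega> \<in> space M. f i (Z i \<omega>) \<in> A}"
    and A: "A \<in> sets (PiM I K)"
  shows "prob {\<omega> \<in> space M. (\<lambda>i\<in>I. f i (Z i \<omega>)) \<in> A \<and> (\<forall>i\<in>I. Z i \<omega> \<in> E i)} =
    (\<Prod>i\<in>I. c i) * prob {\<omega> \<in> space M. (\<lambda>i\<in>I. f i (Z i \<omega>)) \<in> A}"
proof -
  have Z[measurable]: "Z i \<in> measurable M (N i)" if "i \<in> I" for i
    using indep that by (auto simp: indep_vars_def)
  define T where "T \<omega> = (\<lambda>i\<in>I. f i (Z i \<omega>))" for \<omega>
  define S where "S = {\<omega> \<in> space M. \<forall>i\<in>I. Z i \<omega> \<in> E i}"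
  have fZ: "(\<lambda>\<omega>. f i (Z i \<omega>)) \<in> measurable M (K i)" if "i \<in> I" for i
    using measurable_compose[OF Z f] that by auto
  have T[measurable]: "T \<in> measurable M (PiM I K)"
    unfolding T_def using fZ by (rule measurable_restrict)
  have S: "S \<in> events"
    unfolding S_def
  proof (intro sets.sets_Collect_finite_All I)
    fix i assume i: "i \<in> I"
    have "{\<omega> \<in> space M. Z i \<omega> \<in> E i} = Z i -` E i \<inter> space M" by blast
    then show "{\<omega> \<in> space M. Z i \<omega> \<in> E i} \<in> events" using Z[OF i] E[OF i] by simp
  qed
  \<comment> \<open>Taking the whole space for the event shows that \<open>c i\<close> is itself a
    probability; its sign is needed to use \<open>prod c I\<close> as a scaling factor of a
    measure.\<close>
  have c0: "0 \<le> c i" if "i \<in> I" for i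
  proof -
    have "{\<omega> \<in> space M. f i (Z i \<omega>) \<in> space (K i)} = space M"
      using fZ[OF that] by (auto dest: measurable_space)
    then show ?thesis using c[OF that, of "space (K i)"] prob_space by (metis measure_nonneg mult.right_neutral sets.top)
  qed
  have box: "prob (S \<inter> T -` Pi\<^sub>E I B \<inter> space M) = prod c I * prob (T -` Pi\<^sub>E I B \<inter> space M)"
    if B: "\<And>i. i \<in> I \<Longrightarrow> B i \<in> sets (K i)" for B
  proof -
    have fB: "f i -` B i \<inter> space (N i) \<in> sets (N i)" if "i \<in> I" for i
      using f B that by (auto intro: measurable_sets)
    have ZN: "Z i \<omega> \<in> space (N i)" if "i \<in> I" "\<omega> \<in> space M" for i \<omega>
      using measurable_space[OF Z] that by blast
    have e1: "S \<inter> T -` Pi\<^sub>E I B \<inter> space M = (\<Inter>i\<in>I. Z i -` (f i -` B i \<inter> space (N i) \<inter> E i) \<inter> space M)"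
      using I ZN by (auto simp: S_def T_def PiE_iff)
    have e2: "T -` Pi\<^sub>E I B \<inter> space M = (\<Inter>i\<in>I. Z i -` (f i -` B i \<inter> space (N i)) \<inter> space M)"
      using I ZN by (auto simp: S_def T_def PiE_iff)
    have e3: "Z i -` (f i -` B i \<inter> space (N i) \<inter> E i) \<inter> space M = {\<omega> \<in> space M. f i (Z i \<omega>) \<in> B i \<and> Z i \<omega> \<in> E i}"
      "Z i -` (f i -` B i \<inter> space (N i)) \<inter> space M = {\<omega> \<in> space M. f i (Z i \<omega>) \<in> B i}" if "i \<in> I" for i
      using that ZN by auto
    have "prob (S \<inter> T -` Pi\<^sub>E I B \<inter> space M) =
        (\<Prod>i\<in>I. prob (Z i -` (f i -` B i \<inter> space (N i) \<inter> E i) \<inter> space M))"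
      unfolding e1 using fB E by (intro indep_varsD_finite[OF indep I(2,1)]) auto
    also have "\<dots> = (\<Prod>i\<in>I. c i * prob (Z i -` (f i -` B i \<inter> space (N i)) \<inter> space M))"
      by (intro prod.cong refl) (simp only: e3 c B)
    also have "\<dots> = prod c I * prob (T -` Pi\<^sub>E I B \<inter> space M)"
      unfolding e2 prod.distrib using fB by (subst indep_varsD_finite[OF indep I(2,1)]) auto
    finally show ?thesis .
  qed
  \<comment> \<open>\<open>P\<close> is the law of \<open>T\<close> restricted to the event
    \<open>S\<close>, and \<open>Q\<close> is the full law of \<open>T\<close> scaled by the product
    of the \<open>c i\<close>.\<close>
  define P where "P = distr (density M (indicator S)) (PiM I K) T"
  define Q where "Q = scale_measure (ennreal (prod c I)) (distr M (PiM I K) T)"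
  have emP: "emeasure P B = ennreal (prob (S \<inter> T -` B \<inter> space M))" if "B \<in> sets (PiM I K)" for B
  proof -
    have "T -` B \<inter> space M \<in> events" using T that by (rule measurable_sets)
    then have "emeasure P B = emeasure M (S \<inter> (T -` B \<inter> space M))"
      unfolding P_def using that S by (simp add: emeasure_distr emeasure_restricted)
    then show ?thesis by (simp add: emeasure_eq_measure Int_assoc)
  qed
  have emQ: "emeasure Q B = ennreal (prod c I * prob (T -` B \<inter> space M))" if "B \<in> sets (PiM I K)" for B
    unfolding Q_def using that c0
    by (simp add: emeasure_distr emeasure_eq_measure ennreal_mult' prod_nonneg)
  have "P = Q"
  proof (rule measure_eqI_PiM_finite[OF I(1)])
    show "sets P = PiM I K" "sets Q = PiM I K" by (simp_all add: P_def Q_def)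
    show "emeasure P (Pi\<^sub>E I B) = emeasure Q (Pi\<^sub>E I B)" if "\<And>i. i \<in> I \<Longrightarrow> B i \<in> sets (K i)" for B
      using that I by (simp add: emP emQ box sets_PiM_I_finite)
    show "range (\<lambda>_::nat. space (PiM I K)) \<subseteq> prod_algebra I K"
      unfolding space_PiM using I by (auto intro!: prod_algebraI_finite)
    show "emeasure P (space (PiM I K)) \<noteq> \<infinity>" by (simp add: emP)
  qed auto
  then have "ennreal (prob (S \<inter> T -` A \<inter> space M)) = ennreal (prod c I * prob (T -` A \<inter> space M))"
    using emP[OF A] emQ[OF A] by simp
  then have "prob (S \<inter> T -` A \<inter> space M) = prod c I * prob (T -` A \<inter> space M)"
    using c0 by (simp add: prod_nonneg)
  moreover have "S \<inter> T -` A \<inter> space M = {\<omega> \<in> space M. (\<lambda>i\<in>I. f i (Z i \<omega>)) \<in> A \<and> (\<forall>i\<in>I. Z i \<omega> \<in> E i)}"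
    "T -` A \<inter> space M = {\<omega> \<in> space M. (\<lambda>i\<in>I. f i (Z i \<omega>)) \<in> A}"
    by (auto simp: S_def T_def)
  ultimately show ?thesis by simp
qed

section \<open>Null events for vectors with a density\<close>

text \<open>A hyperplane is a Lebesgue null set, hence null for any law with a density.\<close>

lemma (in prob_space) AE_inner_ne_zero:
  fixes X :: "'a \<Rightarrow> 'v::euclidean_space"
  assumes "distributed M lborel X f" "a \<noteq> 0"
  shows "AE \<omega> in M. X \<omega> \<bullet> a \<noteq> 0"
proof -
  have "negligible {x. a \<bullet> x = 0}" using assms(2) by (intro negligible_hyperplane) auto
  moreover have [measurable]: "{x. a \<bullet> x = 0} \<in> sets lborel" by measurable
  ultimately have "AE x in lborel. x \<notin> {x. a \<bullet> x = 0}"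
    by (intro AE_not_in) (auto simp: null_sets_def negligible_iff_emeasure0)
  then have "AE x in lborel. x \<bullet> a \<noteq> 0" by (simp add: inner_commute)
  moreover have X: "distr M lborel X = density lborel f" "X \<in> measurable M lborel" "f \<in> borel_measurable lborel"
    using assms(1) by (auto simp: distributed_def)
  ultimately have "AE x in distr M lborel X. x \<bullet> a \<noteq> 0"
    unfolding X(1) by (subst AE_density) (auto elim: eventually_mono)
  then show ?thesis using AE_distrD[OF X(2)] by blast
qed

text \<open>For a fixed nonzero value of \<open>X\<close> the determinant is a nonzero linear
  functional of \<open>X'\<close>, so it vanishes only on a null set; independence turns the joint
  law into a product, and Fubini gives the claim.\<close>

lemma (in prob_space) AE_not_collinear:
  fixes X X' :: "'a \<Rightarrow> real ^ 2"
  assumes indep: "indep_var borel X borel X'"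
    and X: "distributed M lborel X f" and X': "distributed M lborel X' g"
  shows "AE \<omega> in M. X \<omega> $ 1 * X' \<omega> $ 2 - X \<omega> $ 2 * X' \<omega> $ 1 \<noteq> 0"
proof -
  have [measurable]: "X \<in> borel_measurable M" "X' \<in> borel_measurable M"
    using X X' by (auto simp: distributed_def)
  have [measurable]: "(\<lambda>x :: real ^ 2. x $ i) \<in> borel_measurable borel" for i
    by (intro borel_measurable_continuous_onI continuous_intros)
  interpret D: prob_space "distr M borel X" by (rule prob_space_distr) simp
  interpret D': prob_space "distr M borel X'" by (rule prob_space_distr) simp
  interpret pair_sigma_finite "distr M borel X" "distr M borel X'" ..
  have eq: "distr M borel X \<Otimes>\<^sub>M distr M borel X' = distr M (borel \<Otimes>\<^sub>M borel) (\<lambda>\<omega>. (X \<omega>, X' \<omega>))"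
    using indep by (simp add: indep_var_distribution_eq)
  \<comment> \<open>A nonvanishing first coordinate is a convenient witness that \<open>X\<close> is
    nonzero.\<close>
  have "AE \<omega> in M. X \<omega> \<bullet> axis 1 1 \<noteq> 0"
    by (rule AE_inner_ne_zero[OF X]) (simp add: axis_eq_0_iff)
  then have "AE x in distr M borel X. x \<bullet> axis 1 1 \<noteq> 0"
    by (subst AE_distr_iff) auto
  then have "AE x in distr M borel X. AE y in distr M borel X'. x $ 1 * y $ 2 - x $ 2 * y $ 1 \<noteq> 0"
  proof eventually_elim
    case (elim x)
    \<comment> \<open>The vector \<open>a\<close> is \<open>x\<close> turned by a right angle, so
      that \<open>y \<bullet> a\<close> is the determinant of \<open>x\<close> and
      \<open>y\<close>.\<close>
    define a :: "real ^ 2" where "a = (\<chi> i. if i = 1 then - x $ 2 else x $ 1)"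
    have "a \<noteq> 0" using elim by (auto simp: a_def vec_eq_iff inner_axis exI[of _ 2])
    from AE_inner_ne_zero[OF X' this]
    have "AE y in distr M borel X'. y \<bullet> a \<noteq> 0" by (subst AE_distr_iff) auto
    then show ?case
      by eventually_elim (simp add: a_def inner_vec_def sum_2 algebra_simps)
  qed
  moreover have "{z \<in> space (borel \<Otimes>\<^sub>M borel).
      (fst z :: real ^ 2) $ 1 * (snd z :: real ^ 2) $ 2 - (fst z) $ 2 * (snd z) $ 1 \<noteq> 0} \<in> sets (borel \<Otimes>\<^sub>M borel)"
    by measurable
  ultimately have "AE z in distr M borel X \<Otimes>\<^sub>M distr M borel X'.
      (fst z) $ 1 * (snd z) $ 2 - (fst z) $ 2 * (snd z) $ 1 \<noteq> 0"
    by (intro AE_pair_measure, unfold fst_conv snd_conv)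
      (simp_all add: space_pair_measure cong: sets_pair_measure_cong)
  then show ?thesis unfolding eq by (auto dest!: AE_distrD[rotated])
qed

subsection \<open>Separability in the plane\<close>

text \<open>The counterclockwise quarter turn. It completes a unit vector \<beta> to an orthonormal
  basis of the plane.\<close>

definition rotate90 :: "real ^ 2 \<Rightarrow> real ^ 2" where
  "rotate90 v = (\<chi> i. if i = 1 then - v $ 2 else v $ 1)"

lemma rotate90_nth [simp]: "rotate90 v $ 1 = - v $ 2" "rotate90 v $ 2 = v $ 1"
  by (simp_all add: rotate90_def)

lemma norm_eq_1_real2: "norm (v :: real ^ 2) = 1 \<longleftrightarrow> (v $ 1)\<^sup>2 + (v $ 2)\<^sup>2 = 1"
  by (simp add: norm_eq_1 inner_vec_def sum_2 power2_eq_square)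

lemma rotate90_decomposition:
  assumes "norm \<beta> = 1"
  shows "b = (b \<bullet> \<beta>) *\<^sub>R \<beta> + (b \<bullet> rotate90 \<beta>) *\<^sub>R rotate90 \<beta>"
proof -
  have n: "(\<beta> $ 1)\<^sup>2 + (\<beta> $ 2)\<^sup>2 = 1" using assms by (simp add: norm_eq_1_real2)
  \<comment> \<open>Each coordinate is multiplied by the squared norm of \<beta>; after expansion
    the mixed terms cancel.\<close>
  have "b $ 1 = b $ 1 * ((\<beta> $ 1)\<^sup>2 + (\<beta> $ 2)\<^sup>2)" "b $ 2 = b $ 2 * ((\<beta> $ 1)\<^sup>2 + (\<beta> $ 2)\<^sup>2)"
    by (simp_all add: n)
  then show ?thesis
    by (simp add: vec_eq_iff forall_2 inner_vec_def sum_2 power2_eq_square algebra_simps)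
qed

text \<open>Factoring \<open>x \<bullet> \<beta>\<close> out of the inner product leaves
  \<open>a + c * t\<close> with \<open>t\<close> the slope of \<open>x\<close>. The product of the
  label and \<open>x \<bullet> \<beta>\<close> is positive if \<open>s\<close> holds and negative
  otherwise, so only the sign of the affine factor remains to be compared with
  \<open>s\<close>.\<close>

lemma flip_label_mult_inner_pos_iff:
  fixes x \<beta> :: "real ^ 2"
  assumes "x \<bullet> \<beta> \<noteq> 0"
  shows "0 < flip_label \<beta> s x * (x \<bullet> (a *\<^sub>R \<beta> + c *\<^sub>R \<gamma>)) \<longleftrightarrow>
    (if s then 0 < a + c * ((x \<bullet> \<gamma>) / (x \<bullet> \<beta>)) else a + c * ((x \<bullet> \<gamma>) / (x \<bullet> \<beta>)) < 0)"
proof -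
  have "x \<bullet> (a *\<^sub>R \<beta> + c *\<^sub>R \<gamma>) = (x \<bullet> \<beta>) * (a + c * ((x \<bullet> \<gamma>) / (x \<bullet> \<beta>)))"
    using assms by (simp add: inner_add_right field_simps)
  then show ?thesis
    using assms by (auto simp: flip_label_def zero_less_mult_iff mult_less_0_iff)
qed

text \<open>Every direction is a combination of \<beta> and its quarter turn, so searching for a
  direction is the same as searching for the coefficients of an affine function of the
  slope.\<close>

lemma exists_direction_flip_label_iff:
  fixes x :: "'i \<Rightarrow> real ^ 2"
  assumes "norm \<beta> = 1" "P \<subseteq> I" and nz: "\<And>i. i \<in> I \<Longrightarrow> x i \<bullet> \<beta> \<noteq> 0"
  defines "t \<equiv> \<lambda>i. (x i \<bullet> rotate90 \<beta>) / (x i \<bullet> \<beta>)"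
  shows "(\<exists>b. \<forall>i\<in>I. 0 < flip_label \<beta> (i \<in> P) (x i) * (x i \<bullet> b)) \<longleftrightarrow>
    (\<exists>a c. (\<forall>i\<in>P. 0 < a + c * t i) \<and> (\<forall>i\<in>I - P. a + c * t i < 0))"
proof -
  have "(\<exists>b. \<forall>i\<in>I. 0 < flip_label \<beta> (i \<in> P) (x i) * (x i \<bullet> b)) \<longleftrightarrow>
    (\<exists>a c. \<forall>i\<in>I. 0 < flip_label \<beta> (i \<in> P) (x i) * (x i \<bullet> (a *\<^sub>R \<beta> + c *\<^sub>R rotate90 \<beta>)))"
    by (metis rotate90_decomposition[OF assms(1)])
  also have "\<dots> \<longleftrightarrow> (\<exists>a c. \<forall>i\<in>I. if i \<in> P then 0 < a + c * t i else a + c * t i < 0)"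
    by (simp add: flip_label_mult_inner_pos_iff nz t_def)
  also have "\<dots> \<longleftrightarrow> (\<exists>a c. (\<forall>i\<in>P. 0 < a + c * t i) \<and> (\<forall>i\<in>I - P. a + c * t i < 0))"
  proof -
    have "(\<forall>i\<in>I. if i \<in> P then 0 < a + c * t i else a + c * t i < 0) \<longleftrightarrow>
      (\<forall>i\<in>P. 0 < a + c * t i) \<and> (\<forall>i\<in>I - P. a + c * t i < 0)" for a c
      using assms(2) by auto
    then show ?thesis by simp
  qed
  finally show ?thesis .
qed

text \<open>Cross-multiplied, a coincidence of slopes says that the determinant of the two vectors
  vanishes when computed in the basis formed by \<beta> and its quarter turn. That change of basis
  preserves determinants, so the vectors would be collinear.\<close>

lemma inj_on_slope:
  fixes x :: "'i \<Rightarrow> real ^ 2"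
  assumes "norm \<beta> = 1" and nz: "\<And>i. i \<in> I \<Longrightarrow> x i \<bullet> \<beta> \<noteq> 0"
    and nc: "\<And>i j. i \<in> I \<Longrightarrow> j \<in> I \<Longrightarrow> i \<noteq> j \<Longrightarrow> x i $ 1 * x j $ 2 - x i $ 2 * x j $ 1 \<noteq> 0"
  shows "inj_on (\<lambda>i. (x i \<bullet> rotate90 \<beta>) / (x i \<bullet> \<beta>)) I"
proof (rule inj_onI, rule ccontr)
  fix i j assume ij: "i \<in> I" "j \<in> I" "i \<noteq> j"
    and eq: "(x i \<bullet> rotate90 \<beta>) / (x i \<bullet> \<beta>) = (x j \<bullet> rotate90 \<beta>) / (x j \<bullet> \<beta>)"
  have n: "(\<beta> $ 1)\<^sup>2 + (\<beta> $ 2)\<^sup>2 = 1" using assms(1) by (simp add: norm_eq_1_real2)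
  have "(x i $ 1 * x j $ 2 - x i $ 2 * x j $ 1) * ((\<beta> $ 1)\<^sup>2 + (\<beta> $ 2)\<^sup>2) =
      (x j \<bullet> rotate90 \<beta>) * (x i \<bullet> \<beta>) - (x i \<bullet> rotate90 \<beta>) * (x j \<bullet> \<beta>)"
    by (simp add: inner_vec_def sum_2 power2_eq_square algebra_simps)
  also have "\<dots> = 0" using eq nz ij by (simp add: frac_eq_eq)
  finally show False using nc[OF ij] n by simp
qed

text \<open>The two variables are read off from the restrictions of the family to the disjoint index
  sets \<open>{i}\<close> and \<open>{j}\<close>.\<close>

lemma (in prob_space) indep_var_component:
  assumes indep: "indep_vars N X I" and ij: "i \<in> I" "j \<in> I" "i \<noteq> j"
  shows "indep_var (N i) (X i) (N j) (X j)"
proof -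
  have "indep_var (N i) ((\<lambda>f. f i) \<circ> (\<lambda>\<omega>. \<lambda>k\<in>{i}. X k \<omega>)) (N j) ((\<lambda>f. f j) \<circ> (\<lambda>\<omega>. \<lambda>k\<in>{j}. X k \<omega>))"
    using ij by (intro indep_var_compose[OF indep_var_restrict[OF indep]]) auto
  then show ?thesis by (simp add: comp_def)
qed

lemma (in prob_space) AE_general_position:
  fixes X :: "'i \<Rightarrow> 'a \<Rightarrow> real ^ 2"
  assumes "finite I" and indep: "indep_vars (\<lambda>_. borel) X I"
    and X: "\<And>i. i \<in> I \<Longrightarrow> distributed M lborel (X i) (f i)" and "\<beta> \<noteq> 0"
  shows "AE \<omega> in M. (\<forall>i\<in>I. X i \<omega> \<bullet> \<beta> \<noteq> 0) \<and>
    (\<forall>i\<in>I. \<forall>j\<in>I. i \<noteq> j \<longrightarrow> X i \<omega> $ 1 * X j \<omega> $ 2 - X i \<omega> $ 2 * X j \<omega> $ 1 \<noteq> 0)"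
proof -
  have "AE \<omega> in M. X i \<omega> $ 1 * X j \<omega> $ 2 - X i \<omega> $ 2 * X j \<omega> $ 1 \<noteq> 0"
    if "i \<in> I" "j \<in> I" "i \<noteq> j" for i j
    using AE_not_collinear[OF indep_var_component[OF indep that] X X] that by blast
  moreover have "AE \<omega> in M. X i \<omega> \<bullet> \<beta> \<noteq> 0" if "i \<in> I" for i
    using AE_inner_ne_zero[OF X[OF that] assms(4)] .
  ultimately show ?thesis
    using assms(1) by (simp add: AE_finite_all)
qed

section \<open>The probability of separability\<close>

theorem corollary1:
  fixes M :: "'w measure" and n :: nat
    and X :: "nat \<Rightarrow> 'w \<Rightarrow> real ^ 2" and Y :: "nat \<Rightarrow> 'w \<Rightarrow> real" and \<delta> :: real
  assumes "prob_space M"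
    and "n > 2"
    and "iid M (borel \<Otimes>\<^sub>M count_space {-1, 1}) {1..n} (\<lambda>j \<omega>. (X j \<omega>, Y j \<omega>))"
    and "\<And>j. j \<in> {1..n} \<Longrightarrow> distributed M lborel (X j) (\<lambda>x. ennreal (std_normal_vec_density x))"
    and "sign_flip_noise M n X Y \<delta>"
  shows "separability_prob M n X Y =
    \<delta> ^ n + (1 - \<delta>) ^ n + 2 * (\<Sum>N = 1..n - 1. \<delta> ^ N * (1 - \<delta>) ^ (n - N))"
proof -
  interpret prob_space M by fact
  define I where "I = {1..n}"
  have I: "finite I" "I \<noteq> {}" "card I = n" using assms(2) by (auto simp: I_def)
  obtain \<beta> :: "real ^ 2" where \<beta>: "norm \<beta> = 1" and
    cp: "\<And>j. j \<in> I \<Longrightarrow> AE \<omega> in M. cond_prob_given M {\<omega> \<in> space M. Y j \<omega> = 1} (X j) \<omega> =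
      (if 0 < X j \<omega> \<bullet> \<beta> then \<delta> else 1 - \<delta>)"
    using assms(5) unfolding sign_flip_noise_def I_def by auto
  have indep: "indep_vars (\<lambda>_. borel \<Otimes>\<^sub>M count_space {-1, 1}) (\<lambda>j \<omega>. (X j \<omega>, Y j \<omega>)) I"
    using assms(3) by (simp add: iid_def I_def)
  have Z: "(\<lambda>\<omega>. (X j \<omega>, Y j \<omega>)) \<in> measurable M (borel \<Otimes>\<^sub>M count_space {-1, 1})" if "j \<in> I" for j
    using indep that by (auto simp: indep_vars_def)
  have snd_borel: "snd \<in> borel_measurable ((borel :: (real ^ 2) measure) \<Otimes>\<^sub>M count_space {-1, 1 :: real})"
    by (rule measurable_compose[OF measurable_snd]) simp
  have X: "X j \<in> borel_measurable M" if "j \<in> I" for j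
    using measurable_compose[OF Z[OF that] measurable_fst] by simp
  have Y: "Y j \<in> borel_measurable M" if "j \<in> I" for j
    using measurable_compose[OF Z[OF that] snd_borel] by simp
  have Y_range: "Y j \<omega> \<in> {- 1, 1}" if "j \<in> I" "\<omega> \<in> space M" for j \<omega>
    using measurable_space[OF Z[OF that(1)] that(2)] by (simp add: space_pair_measure)
  have indep_X: "indep_vars (\<lambda>_. borel) X I"
    using indep_vars_compose2[OF indep, of "\<lambda>_. fst" "\<lambda>_. borel"] by simp

  \<comment> \<open>\<open>?w P\<close> is the factor contributed by the agreement pattern
    \<open>P\<close>: \<delta> for each index in \<open>P\<close> and \<open>1 - \<delta>\<close>
    for each other index of \<open>I\<close>.\<close>
  let ?w = "\<lambda>P. \<delta> ^ card P * (1 - \<delta>) ^ card (I - P)"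
  let ?val = "\<delta> ^ n + (1 - \<delta>) ^ n + 2 * (\<Sum>N = 1..n - 1. \<delta> ^ N * (1 - \<delta>) ^ (n - N))"
  let ?sep = "\<lambda>P x. \<exists>b. \<forall>i\<in>I. 0 < flip_label \<beta> (i \<in> P) (x i) * (x i \<bullet> b)"
  \<comment> \<open>\<open>G P\<close> constrains only the regressors: labels with pattern
    \<open>P\<close> would be separable. \<open>E P\<close> adds that the actual labels have pattern
    \<open>P\<close>.\<close>
  define T where "T \<omega> = (\<lambda>i\<in>I. X i \<omega>)" for \<omega>
  define G where "G P = {x \<in> space (\<Pi>\<^sub>M i\<in>I. borel). ?sep P x}" for P
  define E where "E P = {\<omega> \<in> space M. T \<omega> \<in> G P \<and> (\<forall>i\<in>I. Y i \<omega> = flip_label \<beta> (i \<in> P) (X i \<omega>))}" for P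
  have T[measurable]: "T \<in> measurable M (\<Pi>\<^sub>M i\<in>I. borel)"
    unfolding T_def using X by (rule measurable_restrict)
  have G[measurable]: "G P \<in> sets (\<Pi>\<^sub>M i\<in>I. borel)" for P
    unfolding G_def
  proof (rule sets_exists_separating_direction[OF I(1)])
    fix i assume i: "i \<in> I"
    then show 1: "(\<lambda>x. x i) \<in> borel_measurable (\<Pi>\<^sub>M i\<in>I. borel)" by measurable
    show "(\<lambda>x. flip_label \<beta> (i \<in> P) (x i)) \<in> borel_measurable (\<Pi>\<^sub>M i\<in>I. borel)"
      by (rule measurable_compose[OF 1 borel_measurable_flip_label])
  qed
  have T_in_G: "T \<omega> \<in> G P \<longleftrightarrow> ?sep P (\<lambda>i. X i \<omega>)" if "\<omega> \<in> space M" for \<omega> P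
    using measurable_space[OF T that] by (simp add: G_def T_def)
  have E_sets: "E P \<in> events" for P
  proof -
    have "{\<omega> \<in> space M. Y i \<omega> = flip_label \<beta> (i \<in> P) (X i \<omega>)} \<in> events" if "i \<in> I" for i
      using X[OF that] Y[OF that] by measurable
    moreover have "{\<omega> \<in> space M. T \<omega> \<in> G P} \<in> events" by measurable
    ultimately show ?thesis unfolding E_def using I(1)
      by (intro sets.sets_Collect_conj sets.sets_Collect_finite_All)
  qed

  \<comment> \<open>Each label agrees or disagrees independently of its own regressor, and the pairs
    are independent, so the pattern decouples from the event about all regressors.\<close>
  have prob_E: "prob (E P) = ?w P * prob {\<omega> \<in> space M. T \<omega> \<in> G P}" if "P \<subseteq> I" for P
  proof -
    let ?F = "\<lambda>i. {z \<in> space (borel \<Otimes>\<^sub>M count_space {-1, 1 :: real}). snd z = flip_label \<beta> (i \<in> P) (fst z)}"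
    let ?c = "\<lambda>i. if i \<in> P then \<delta> else 1 - \<delta>"
    have F_iff: "(X i \<omega>, Y i \<omega>) \<in> ?F i \<longleftrightarrow> Y i \<omega> = flip_label \<beta> (i \<in> P) (X i \<omega>)"
      if "i \<in> I" "\<omega> \<in> space M" for i \<omega>
      using measurable_space[OF Z[OF that(1)] that(2)] by simp
    have "prob {\<omega> \<in> space M. (\<lambda>i\<in>I. fst (X i \<omega>, Y i \<omega>)) \<in> G P \<and> (\<forall>i\<in>I. (X i \<omega>, Y i \<omega>) \<in> ?F i)} =
        (\<Prod>i\<in>I. ?c i) * prob {\<omega> \<in> space M. (\<lambda>i\<in>I. fst (X i \<omega>, Y i \<omega>)) \<in> G P}"
    proof (rule prob_indep_vars_restrict[OF indep I(1,2)])
      fix i assume i: "i \<in> I"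
      show "?F i \<in> sets (borel \<Otimes>\<^sub>M count_space {-1, 1})"
        using snd_borel by measurable
      fix A :: "(real ^ 2) set" assume A: "A \<in> sets borel"
      show "prob {\<omega> \<in> space M. fst (X i \<omega>, Y i \<omega>) \<in> A \<and> (X i \<omega>, Y i \<omega>) \<in> ?F i} =
          ?c i * prob {\<omega> \<in> space M. fst (X i \<omega>, Y i \<omega>) \<in> A}"
        using prob_flip_label[OF X[OF i] Y[OF i] Y_range[OF i] cp[OF i] A, of "i \<in> P"] F_iff[OF i]
        by (simp cong: conj_cong)
    qed (use G in measurable)
    moreover have "(\<Prod>i\<in>I. ?c i) = ?w P"
      using I(1) that by (simp add: prod.If_cases Int_absorb1 Diff_eq)
    moreover have "{\<omega> \<in> space M. (\<lambda>i\<in>I. fst (X i \<omega>, Y i \<omega>)) \<in> G P \<and> (\<forall>i\<in>I. (X i \<omega>, Y i \<omega>) \<in> ?F i)} = E P"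
      using F_iff by (auto simp: E_def T_def)
    ultimately show ?thesis by (simp add: T_def)
  qed

  \<comment> \<open>Every outcome has exactly one agreement pattern, so the separability event
    splits into the disjoint events \<open>E P\<close>.\<close>
  have "{\<omega> \<in> space M. \<exists>b. \<forall>j\<in>{1..n}. Y j \<omega> * (X j \<omega> \<bullet> b) > 0} = (\<Union>P\<in>Pow I. E P)"
  proof (intro set_eqI iffI)
    fix \<omega> assume "\<omega> \<in> {\<omega> \<in> space M. \<exists>b. \<forall>j\<in>{1..n}. Y j \<omega> * (X j \<omega> \<bullet> b) > 0}"
    then obtain b where \<omega>: "\<omega> \<in> space M" and b: "\<And>i. i \<in> I \<Longrightarrow> 0 < Y i \<omega> * (X i \<omega> \<bullet> b)"
      unfolding I_def by blast
    define P where "P = {i \<in> I. Y i \<omega> = flip_label \<beta> True (X i \<omega>)}"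
    have "Y i \<omega> = flip_label \<beta> (i \<in> P) (X i \<omega>)" if "i \<in> I" for i
      using Y_range[OF that \<omega>] that by (auto simp: P_def flip_label_def)
    then have "\<omega> \<in> E P" using b \<omega> by (auto simp: E_def T_in_G)
    then show "\<omega> \<in> (\<Union>P\<in>Pow I. E P)" by (auto simp: P_def)
  next
    fix \<omega> assume "\<omega> \<in> (\<Union>P\<in>Pow I. E P)"
    then obtain P where "\<omega> \<in> E P" by blast
    then have "\<omega> \<in> space M" "?sep P (\<lambda>i. X i \<omega>)" "\<forall>i\<in>I. Y i \<omega> = flip_label \<beta> (i \<in> P) (X i \<omega>)"
      by (auto simp: E_def T_in_G)
    then show "\<omega> \<in> {\<omega> \<in> space M. \<exists>b. \<forall>j\<in>{1..n}. Y j \<omega> * (X j \<omega> \<bullet> b) > 0}"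
      by (simp add: I_def)
  qed
  then have "separability_prob M n X Y = prob (\<Union>P\<in>Pow I. E P)"
    by (simp add: separability_prob_def)
  also have "\<dots> = (\<Sum>P\<in>Pow I. prob (E P))"
  proof (rule finite_measure_finite_Union)
    show "disjoint_family_on E (Pow I)"
    proof (unfold disjoint_family_on_def, intro ballI impI, rule ccontr)
      fix P Q assume PQ: "P \<in> Pow I" "Q \<in> Pow I" "P \<noteq> Q" "E P \<inter> E Q \<noteq> {}"
      then obtain \<omega> where \<omega>: "\<omega> \<in> E P" "\<omega> \<in> E Q" by blast
      have "i \<in> P \<longleftrightarrow> i \<in> Q" if "i \<in> I" for i
      proof -
        have "flip_label \<beta> (i \<in> P) (X i \<omega>) = flip_label \<beta> (i \<in> Q) (X i \<omega>)"
          using \<omega> that by (simp add: E_def)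
        then show ?thesis by (auto simp: flip_label_def split: if_splits)
      qed
      with PQ show False by blast
    qed
  qed (use I(1) E_sets in auto)
  also have "\<dots> = (\<Sum>P\<in>Pow I. ?w P * prob {\<omega> \<in> space M. T \<omega> \<in> G P})"
    by (simp add: prob_E)
  also have "\<dots> = (\<Sum>P\<in>Pow I. \<integral>\<omega>. ?w P * indicat_real {\<omega> \<in> space M. T \<omega> \<in> G P} \<omega> \<partial>M)"
    by simp
  \<comment> \<open>Exchanging sum and expectation leads to a sum over patterns for a fixed
    configuration, where the combinatorial identity applies.\<close>
  also have "\<dots> = (\<integral>\<omega>. (\<Sum>P\<in>Pow I. ?w P * indicat_real {\<omega> \<in> space M. T \<omega> \<in> G P} \<omega>) \<partial>M)"
    by (rule Bochner_Integration.integral_sum[symmetric])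
      (simp add: integrable_indicator_iff emeasure_eq_measure)
  also have "\<dots> = (\<integral>\<omega>. ?val \<partial>M)"
  proof (rule integral_cong_AE)
    have "\<beta> \<noteq> 0" using \<beta> by auto
    then have "AE \<omega> in M. (\<forall>i\<in>I. X i \<omega> \<bullet> \<beta> \<noteq> 0) \<and>
        (\<forall>i\<in>I. \<forall>j\<in>I. i \<noteq> j \<longrightarrow> X i \<omega> $ 1 * X j \<omega> $ 2 - X i \<omega> $ 2 * X j \<omega> $ 1 \<noteq> 0)"
      using assms(4) by (intro AE_general_position[OF I(1) indep_X]) (auto simp: I_def)
    then show "AE \<omega> in M. (\<Sum>P\<in>Pow I. ?w P * indicat_real {\<omega> \<in> space M. T \<omega> \<in> G P} \<omega>) = ?val"
    proof (rule AE_mp, intro AE_I2 impI)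
      fix \<omega> assume \<omega>: "\<omega> \<in> space M" and
        gp: "(\<forall>i\<in>I. X i \<omega> \<bullet> \<beta> \<noteq> 0) \<and>
          (\<forall>i\<in>I. \<forall>j\<in>I. i \<noteq> j \<longrightarrow> X i \<omega> $ 1 * X j \<omega> $ 2 - X i \<omega> $ 2 * X j \<omega> $ 1 \<noteq> 0)"
      define t where "t i = (X i \<omega> \<bullet> rotate90 \<beta>) / (X i \<omega> \<bullet> \<beta>)" for i
      \<comment> \<open>For this outcome the patterns with \<open>T \<omega> \<in> G P\<close> are
        exactly the index sets cut out by affine functions of the slopes \<open>t\<close>, which are
        pairwise distinct by general position.\<close>
      let ?aff = "\<lambda>P. \<exists>a c. (\<forall>i\<in>P. 0 < a + c * t i) \<and> (\<forall>i\<in>I - P. a + c * t i < 0)"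
      have "inj_on t I"
        unfolding t_def using gp by (intro inj_on_slope[OF \<beta>]) auto
      have "(\<Sum>P\<in>Pow I. ?w P * indicat_real {\<omega> \<in> space M. T \<omega> \<in> G P} \<omega>) =
          (\<Sum>P\<in>Pow I. if ?aff P then ?w P else 0)"
      proof (rule sum.cong[OF refl])
        fix P assume "P \<in> Pow I"
        then have "T \<omega> \<in> G P \<longleftrightarrow> ?aff P"
          unfolding T_in_G[OF \<omega>] t_def using gp
          by (intro exists_direction_flip_label_iff[OF \<beta>]) auto
        then show "?w P * indicat_real {\<omega> \<in> space M. T \<omega> \<in> G P} \<omega> = (if ?aff P then ?w P else 0)"
          using \<omega> by (auto simp: indicator_def)
      qed
      also have "\<dots> = (\<Sum>P | P \<subseteq> I \<and> ?aff P. ?w P)"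
        using I(1) by (simp add: sum.inter_filter[symmetric])
      also have "\<dots> = ?val"
        using sum_affine_separable_subsets[OF I(1) \<open>inj_on t I\<close> I(2), of \<delta> "1 - \<delta>"] by (simp add: I(3))
      finally show "(\<Sum>P\<in>Pow I. ?w P * indicat_real {\<omega> \<in> space M. T \<omega> \<in> G P} \<omega>) = ?val" .
    qed
  qed measurable
  also have "\<dots> = ?val" by (simp add: prob_space)
  finally show ?thesis .
qed

end
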